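(* Every infinite graph $\Gamma$ which is locally finite and connected admits a translation-like action $\ast$ by $\mathbb{Z}$. Moreover, the action can be taken with $d_\Gamma(v,v\ast 1)\leq 3$ for every vertex $v$ of $\Gamma$.
   Context: Graphs are undirected; loops and multiple edges are allowed. A graph is finite when its edge set is finite, and locally finite when every vertex has finite degree. For a connected graph $\Gamma$, $d_\Gamma$ is the path-length metric on the vertex set $V(\Gamma)$. A right action $\ast$ of a group $H$ on a metric space $(X,d)$ is translation-like if it is free (that is, $x\ast h=x$ implies $h=1_H$, for $x\in X$, $h\in H$) and for each $h\in H$ the set $\{d(x,x\ast h)\mid x\in X\}\subset\mathbb{R}$ is bounded. A translation-like action on a connected graph $\Gamma$ is a translation-like action on $(V(\Gamma),d_\Gamma)$. *)

theory Defs
  imports "HOL-Analysis.Analysis" "HOL-Algebra.Elementary_Groups" "HOL-Library.Uprod"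
begin

text \<open>Undirected graphs with loops and multiple edges: each edge is sent to its unordered pair
  of ends; a loop at \<open>v\<close> has the pair \<open>Upair v v\<close>.\<close>

record ('v, 'e) multigraph =
  verts :: "'v set"
  edges :: "'e set"
  ends :: "'e \<Rightarrow> 'v uprod"

definition wf_multigraph :: "('v, 'e, 'm) multigraph_scheme \<Rightarrow> bool" where
  "wf_multigraph G \<longleftrightarrow> (\<forall>e\<in>edges G. set_uprod (ends G e) \<subseteq> verts G)"

definition finite_multigraph :: "('v, 'e, 'm) multigraph_scheme \<Rightarrow> bool" where
  "finite_multigraph G \<longleftrightarrow> finite (edges G)"

text \<open>The edges at \<open>v\<close>. Whether a loop adds one or two to the degree is irrelevant
  to the finiteness of the degree.\<close>

definition incident_edges :: "('v, 'e, 'm) multigraph_scheme \<Rightarrow> 'v \<Rightarrow> 'e set" where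
  "incident_edges G v = {e \<in> edges G. v \<in> set_uprod (ends G e)}"

definition locally_finite_multigraph :: "('v, 'e, 'm) multigraph_scheme \<Rightarrow> bool" where
  "locally_finite_multigraph G \<longleftrightarrow> (\<forall>v\<in>verts G. finite (incident_edges G v))"

inductive edge_path :: "('v, 'e, 'm) multigraph_scheme \<Rightarrow> 'v \<Rightarrow> 'e list \<Rightarrow> 'v \<Rightarrow> bool" for G where
  Nil: "v \<in> verts G \<Longrightarrow> edge_path G v [] v"
| Cons: "\<lbrakk>e \<in> edges G; ends G e = Upair u v; edge_path G v es w\<rbrakk> \<Longrightarrow> edge_path G u (e # es) w"

definition connected_multigraph :: "('v, 'e, 'm) multigraph_scheme \<Rightarrow> bool" where
  "connected_multigraph G \<longleftrightarrow> (\<forall>u\<in>verts G. \<forall>v\<in>verts G. \<exists>es. edge_path G u es v)"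

definition path_dist :: "('v, 'e, 'm) multigraph_scheme \<Rightarrow> 'v \<Rightarrow> 'v \<Rightarrow> real" where
  "path_dist G u v = real (LEAST n. \<exists>es. edge_path G u es v \<and> length es = n)"

locale right_group_action = group H
  for H :: "('h, 'm) monoid_scheme" (structure) and X :: "'x set" and act :: "'x \<Rightarrow> 'h \<Rightarrow> 'x" +
  assumes act_closed: "\<lbrakk>x \<in> X; h \<in> carrier H\<rbrakk> \<Longrightarrow> act x h \<in> X"
    and act_one: "x \<in> X \<Longrightarrow> act x \<one> = x"
    and act_mult: "\<lbrakk>x \<in> X; g \<in> carrier H; h \<in> carrier H\<rbrakk> \<Longrightarrow> act x (g \<otimes> h) = act (act x g) h"

locale translation_like_action = right_group_action H X act + Metric_space X d
  for H :: "('h, 'm) monoid_scheme" (structure) and X :: "'x set"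
    and d :: "'x \<Rightarrow> 'x \<Rightarrow> real" and act :: "'x \<Rightarrow> 'h \<Rightarrow> 'x" +
  assumes free: "\<lbrakk>x \<in> X; h \<in> carrier H; act x h = x\<rbrakk> \<Longrightarrow> h = \<one>"
    and bounded_displacement: "h \<in> carrier H \<Longrightarrow> bounded {d x (act x h) | x. x \<in> X}"

definition translation_like_action_on_graph ::
  "('h, 'n) monoid_scheme \<Rightarrow> ('v, 'e, 'm) multigraph_scheme \<Rightarrow> ('v \<Rightarrow> 'h \<Rightarrow> 'v) \<Rightarrow> bool" where
  "translation_like_action_on_graph H G act \<longleftrightarrow>
    translation_like_action H (verts G) (path_dist G) act"

lemma edge_path_append: "edge_path G u es v \<Longrightarrow> edge_path G v fs w \<Longrightarrow> edge_path G u (es @ fs) w"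
  by (induction rule: edge_path.induct) (auto intro: edge_path.intros)

lemma edge_path_rev:
  assumes "edge_path G u es v" "wf_multigraph G" shows "edge_path G v (rev es) u"
  using assms
proof (induction rule: edge_path.induct)
  case (Nil v)
  then show ?case by (auto intro: edge_path.intros)
next
  case (Cons e u v es w)
  have "u \<in> verts G"
    using Cons.hyps Cons.prems by (auto simp: wf_multigraph_def)
  moreover have "ends G e = Upair v u"
    using Cons.hyps by (simp add: Upair_inject)
  ultimately have "edge_path G v [e] u"
    using Cons.hyps by (auto intro: edge_path.intros)
  then show ?case using Cons edge_path_append by fastforce
qed

lemma path_dist_attained:
  assumes "connected_multigraph G" "u \<in> verts G" "v \<in> verts G"
  obtains es where "edge_path G u es v" "path_dist G u v = real (length es)"
proof -
  have "\<exists>n es. edge_path G u es v \<and> length es = n"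
    using assms by (auto simp: connected_multigraph_def)
  from LeastI_ex[OF this] show ?thesis
    using that by (auto simp: path_dist_def)
qed

lemma path_dist_le: "edge_path G u es v \<Longrightarrow> path_dist G u v \<le> real (length es)"
  by (auto simp: path_dist_def intro!: Least_le)

lemma Metric_space_path_dist:
  assumes "wf_multigraph G" "connected_multigraph G"
  shows "Metric_space (verts G) (path_dist G)"
proof
  show "0 \<le> path_dist G x y" for x y by (simp add: path_dist_def)
  have "(\<exists>es. edge_path G x es y \<and> length es = n) \<longleftrightarrow> (\<exists>es. edge_path G y es x \<and> length es = n)" for x y n
    using edge_path_rev[OF _ assms(1)] by (metis length_rev)
  then show "path_dist G x y = path_dist G y x" for x y by (simp add: path_dist_def)
  show "path_dist G x y = 0 \<longleftrightarrow> x = y" if "x \<in> verts G" "y \<in> verts G" for x y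
  proof
    assume "path_dist G x y = 0"
    moreover obtain es where "edge_path G x es y" "path_dist G x y = real (length es)"
      using path_dist_attained[OF assms(2)] \<open>x \<in> verts G\<close> \<open>y \<in> verts G\<close> by blast
    ultimately show "x = y" by (auto elim: edge_path.cases)
  next
    assume "x = y"
    then have "edge_path G x [] y" using that by (simp add: edge_path.Nil)
    from path_dist_le[OF this] show "path_dist G x y = 0" by (simp add: path_dist_def)
  qed
  show "path_dist G x z \<le> path_dist G x y + path_dist G y z"
    if xyz: "x \<in> verts G" "y \<in> verts G" "z \<in> verts G" for x y z
  proof -
    obtain es where es: "edge_path G x es y" "path_dist G x y = real (length es)"
      using path_dist_attained[OF assms(2) xyz(1,2)] .
    obtain fs where fs: "edge_path G y fs z" "path_dist G y z = real (length fs)"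
      using path_dist_attained[OF assms(2) xyz(2,3)] .
    show ?thesis using path_dist_le[OF edge_path_append[OF es(1) fs(1)]] es(2) fs(2) by simp
  qed
qed

end

theory Submission
  imports Defs "HOL-Algebra.Bij"
begin

text \<open>
  The graph is replaced by a spanning tree rooted at some vertex, in which every edge of the tree is
  an edge of the graph; distances in the graph are at most those in the tree, so it is enough to move
  each vertex a distance of at most 3 along the tree. Call the vertices with infinitely many
  descendants the trunk. The trunk contains the root, and every trunk vertex has a child in the
  trunk; choosing one such child for each of them splits the trunk into descending rays
  \<open>x\<^sub>0, x\<^sub>1, x\<^sub>2, \<dots>\<close>. Every remaining vertex lies in the finite bush of a unique trunk vertex
  \<open>x\<close>: the tree formed by \<open>x\<close> and all branches at \<open>x\<close> that avoid the trunk.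

  A finite tree with root \<open>x\<close> has a tour: an enumeration without repetition that begins at \<open>x\<close>, ends
  at \<open>x\<close> or at a neighbour of \<open>x\<close>, and makes jumps of length at most 3 (lemma \<open>tour_exists\<close>; this
  is the classical argument that the cube of a finite tree is Hamiltonian). Write \<open>L\<^sub>i\<close> for a
  tour of the bush at \<open>x\<^sub>i\<close>. A ray together with its bushes is arranged into the bi-infinite sequence
  \<open>\<dots>, rev L\<^sub>5, rev L\<^sub>3, rev L\<^sub>1, L\<^sub>0, L\<^sub>2, L\<^sub>4, \<dots>\<close>.
  Going down the ray on the even positions, a tour ends within 1 of \<open>x\<^sub>2\<^sub>i\<close> and the next one
  starts at \<open>x\<^sub>2\<^sub>i\<^sub>+\<^sub>2\<close>, at distance at most 2 from \<open>x\<^sub>2\<^sub>i\<close>; the odd half is the mirror image, and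
  the two halves meet in the edge from \<open>x\<^sub>1\<close> to \<open>x\<^sub>0\<close>. So all jumps have length at most 3.

  The bi-infinite sequences of all rays partition the vertex set. The generator of
  \<open>\<int>\<close> moves each vertex to the next entry of its sequence (locale \<open>block_lines\<close>). It
  is a permutation, and no power of it has a fixed point because the position in the sequence
  increases; its powers have bounded displacement by the triangle inequality.
\<close>

section \<open>Actions of the integers generated by one permutation\<close>

text \<open>The function \<open>r\<close> increases strictly along orbits, so that no orbit can close up: this is
  what makes the action free. The action itself consists of the integer powers of \<open>f\<close> in the group
  of all permutations of \<open>X\<close>.\<close>

lemma increasing_bijection_gives_translation_like_action:
  fixes r :: "'x \<Rightarrow> real"
  assumes M: "Metric_space X d"
    and bij: "bij_betw f X X"
    and incr: "\<And>x. x \<in> X \<Longrightarrow> r x < r (f x)"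
    and step: "\<And>x. x \<in> X \<Longrightarrow> d x (f x) \<le> C"
  shows "\<exists>act. translation_like_action integer_group X d act \<and> (\<forall>x\<in>X. act x 1 = f x)"
proof -
  interpret Metric_space X d by (rule M)
  interpret B: group "BijGroup X" by (rule group_BijGroup)
  define F where "F = restrict f X"
  have F: "F \<in> carrier (BijGroup X)"
    using bij by (simp add: F_def BijGroup_def Bij_def bij_betw_def inj_on_def)
  define P where "P n = F [^]\<^bsub>BijGroup X\<^esub> n" for n :: int
  have P_carrier: "P n \<in> carrier (BijGroup X)" for n
    unfolding P_def using F by (rule B.int_pow_closed)
  have P_closed: "P n x \<in> X" if "x \<in> X" for n x
    using P_carrier[of n] that by (auto simp: BijGroup_def Bij_def bij_betw_def)
  have P_0: "P 0 x = x" if "x \<in> X" for x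
    using that by (simp add: P_def BijGroup_def)
  have P_1: "P 1 = F"
    unfolding P_def using F by (rule B.int_pow_1)
  \<comment> \<open>A right action composes in the opposite order to functions, which is harmless since
    powers of one permutation commute.\<close>
  have P_add: "P (m + n) x = P n (P m x)" if "x \<in> X" for m n x
  proof -
    have "P (m + n) = P n \<otimes>\<^bsub>BijGroup X\<^esub> P m"
      unfolding P_def using B.int_pow_mult[OF F, of n m] by (simp add: add.commute)
    also have "\<dots> = compose X (P n) (P m)"
      using P_carrier by (simp add: BijGroup_def)
    finally show ?thesis using that by (simp add: compose_eq)
  qed
  have P_Suc: "P (int (Suc n)) x = f (P (int n) x)" if "x \<in> X" for n x
    using P_add[OF that, of "int n" 1] P_closed[OF that] by (simp add: P_1 F_def add.commute)
  have r_pos: "r x < r (P (int (Suc n)) x)" if "x \<in> X" for n x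
  proof (induction n)
    case 0
    then show ?case using incr[OF that] that P_Suc[OF that, of 0] P_0[OF that] by simp
  next
    case (Suc n)
    then show ?case using P_Suc[OF that, of "Suc n"] incr[OF P_closed[OF that, of "int (Suc n)"]] by simp
  qed
  have no_return: "P n x \<noteq> x" if "x \<in> X" "n > 0" for n x
    using r_pos[OF that(1), of "nat n - 1"] that(2) by auto
  have d_nat: "d x (P (int n) x) \<le> real n * C" if "x \<in> X" for n x
  proof (induction n)
    case 0
    then show ?case using that P_0[OF that] by simp
  next
    case (Suc n)
    have y: "P (int n) x \<in> X" using P_closed[OF that] .
    have "d x (P (int (Suc n)) x) \<le> d x (P (int n) x) + d (P (int n) x) (P (int (Suc n)) x)"
      using triangle that P_closed by blast
    also have "\<dots> \<le> real n * C + C"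
      using Suc step[OF y] P_Suc[OF that, of n] by simp
    finally show ?case by (simp add: algebra_simps)
  qed
  have d_bound: "d x (P n x) \<le> real (nat \<bar>n\<bar>) * C" if "x \<in> X" for n x
  proof (cases "n \<ge> 0")
    case True
    then show ?thesis using d_nat[OF that, of "nat n"] by simp
  next
    case False
    then show ?thesis
      using d_nat[OF P_closed[OF that, of n], of "nat (-n)"] P_add[OF that, of n "-n"] P_0[OF that]
      by (simp add: commute)
  qed
  have "translation_like_action integer_group X d (\<lambda>x n. P n x)"
  proof (intro translation_like_action.intro right_group_action.intro
      right_group_action_axioms.intro translation_like_action_axioms.intro)
    show "group integer_group" by simp
    show "Metric_space X d" by (rule M)
    fix x n assume x: "x \<in> X" and "P n x = x"
    then show "n = \<one>\<^bsub>integer_group\<^esub>"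
      using no_return[OF x, of n] no_return[OF x, of "-n"] P_add[OF x, of n "-n"] P_0[OF x]
      by (cases n "0::int" rule: linorder_cases) auto
  next
    fix n :: int
    have "\<bar>d x (P n x)\<bar> \<le> real (nat \<bar>n\<bar>) * C" if "x \<in> X" for x
      using d_bound[OF that, of n] nonneg by simp
    then show "bounded {d x (P n x) | x. x \<in> X}"
      unfolding bounded_iff by (intro exI[of _ "real (nat \<bar>n\<bar>) * C"]) auto
  qed (use P_closed P_0 P_add in auto)
  then show ?thesis
    by (intro exI[of _ "\<lambda>x n. P n x"]) (simp add: P_1 F_def)
qed

section \<open>Translating along bi-infinite sequences of blocks\<close>

text \<open>For each \<open>s\<close>, the blocks \<open>\<dots>, M s (-1), M s 0, M s 1, \<dots>\<close> concatenate to one bi-infinite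
  sequence. Keeping the blocks apart, rather than numbering the entries by integers, avoids
  summing block lengths.\<close>

locale block_lines = Metric_space X d
  for X :: "'x set" and d :: "'x \<Rightarrow> 'x \<Rightarrow> real" +
  fixes S :: "'s set" and M :: "'s \<Rightarrow> int \<Rightarrow> 'x list" and C :: real
  assumes nonempty: "s \<in> S \<Longrightarrow> M s k \<noteq> []"
    and distinct: "s \<in> S \<Longrightarrow> distinct (M s k)"
    and step_inside: "s \<in> S \<Longrightarrow> successively (\<lambda>x y. d x y \<le> C) (M s k)"
    and step_between: "s \<in> S \<Longrightarrow> d (last (M s k)) (hd (M s (k + 1))) \<le> C"
    and cover: "(\<Union>s\<in>S. \<Union>k. set (M s k)) = X"
    and disjoint: "\<lbrakk>s \<in> S; t \<in> S; x \<in> set (M s k); x \<in> set (M t l)\<rbrakk> \<Longrightarrow> s = t \<and> k = l"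
begin

definition positions :: "('s \<times> int \<times> nat) set" where
  "positions = {(s, k, j). s \<in> S \<and> j < length (M s k)}"

definition entry :: "'s \<times> int \<times> nat \<Rightarrow> 'x" where
  "entry = (\<lambda>(s, k, j). M s k ! j)"

definition next_position :: "'s \<times> int \<times> nat \<Rightarrow> 's \<times> int \<times> nat" where
  "next_position = (\<lambda>(s, k, j). if Suc j < length (M s k) then (s, k, Suc j) else (s, k + 1, 0))"

text \<open>The fractional part orders the entries within a block: it stays below 1, hence any position
  in block \<open>k\<close> is lower than any in block \<open>k + 1\<close>.\<close>

definition height :: "'s \<times> int \<times> nat \<Rightarrow> real" where
  "height = (\<lambda>(s, k, j). of_int k + real j / real (length (M s k)))"

lemma bij_entry: "bij_betw entry positions X"
proof (rule bij_betw_imageI)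
  show "inj_on entry positions"
  proof (rule inj_onI)
    fix q q' assume q: "q \<in> positions" and q': "q' \<in> positions" and eq: "entry q = entry q'"
    obtain s k j t l i where qq: "q = (s, k, j)" "q' = (t, l, i)" by (metis prod_cases3)
    have s: "s \<in> S" "t \<in> S" "j < length (M s k)" "i < length (M t l)" "M s k ! j = M t l ! i"
      using q q' eq by (simp_all add: qq positions_def entry_def)
    then have "s = t \<and> k = l" using disjoint[OF s(1,2), of "M s k ! j" k l] nth_mem by metis
    then show "q = q'" using s distinct[OF s(1), of k] by (simp add: qq nth_eq_iff_index_eq)
  qed
  show "entry ` positions = X"
  proof
    show "entry ` positions \<subseteq> X"
      unfolding cover[symmetric] positions_def entry_def using nth_mem by fast
    show "X \<subseteq> entry ` positions"
    proof
      fix x assume "x \<in> X"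
      then obtain s k where "s \<in> S" "x \<in> set (M s k)" using cover by blast
      then obtain j where "j < length (M s k)" "M s k ! j = x" by (auto simp: in_set_conv_nth)
      then have "(s, k, j) \<in> positions" "entry (s, k, j) = x"
        using \<open>s \<in> S\<close> by (auto simp: positions_def entry_def)
      then show "x \<in> entry ` positions" by blast
    qed
  qed
qed

lemma bij_next_position: "bij_betw next_position positions positions"
proof (rule bij_betw_imageI)
  show "inj_on next_position positions"
    by (auto simp: inj_on_def positions_def next_position_def split: if_splits)
  show "next_position ` positions = positions"
  proof
    show "next_position ` positions \<subseteq> positions"
      using nonempty by (auto simp: positions_def next_position_def split: if_splits)
    show "positions \<subseteq> next_position ` positions"
    proof clarify
      fix s k j assume "(s, k, j) \<in> positions"
      then have s: "s \<in> S" and j: "j < length (M s k)" by (auto simp: positions_def)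
      show "(s, k, j) \<in> next_position ` positions"
      proof (cases j)
        case 0
        have "(s, k - 1, length (M s (k - 1)) - 1) \<in> positions"
          using s nonempty by (simp add: positions_def)
        moreover have "next_position (s, k - 1, length (M s (k - 1)) - 1) = (s, k, j)"
          using 0 s nonempty by (simp add: next_position_def)
        ultimately show ?thesis by (metis imageI)
      next
        case (Suc i)
        then have "(s, k, i) \<in> positions" "next_position (s, k, i) = (s, k, j)"
          using s j by (simp_all add: positions_def next_position_def)
        then show ?thesis by (metis imageI)
      qed
    qed
  qed
qed

lemma height_next_position:
  assumes "q \<in> positions"
  shows "height q < height (next_position q)"
proof -
  obtain s k j where q: "q = (s, k, j)" by (cases q)
  have j: "j < length (M s k)" using assms by (simp add: q positions_def)
  then have "real j / real (length (M s k)) < 1"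
    "real j / real (length (M s k)) < real (Suc j) / real (length (M s k))"
    by (auto simp: divide_simps)
  then show ?thesis by (simp add: q height_def next_position_def)
qed

lemma step_next_position:
  assumes "q \<in> positions"
  shows "d (entry q) (entry (next_position q)) \<le> C"
proof -
  obtain s k j where q: "q = (s, k, j)" by (cases q)
  have s: "s \<in> S" and j: "j < length (M s k)" using assms by (auto simp: q positions_def)
  show ?thesis
  proof (cases "Suc j < length (M s k)")
    case True
    then show ?thesis
      using step_inside[OF s, of k] by (auto simp: q entry_def next_position_def successively_conv_nth)
  next
    case False
    then have "j = length (M s k) - 1" using j by simp
    then show ?thesis
      using False step_between[OF s, of k] nonempty[OF s]
      by (simp add: q entry_def next_position_def last_conv_nth hd_conv_nth)
  qed
qed

lemma translation_like_action:
  "\<exists>act. translation_like_action integer_group X d act \<and> (\<forall>x\<in>X. d x (act x 1) \<le> C)"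
proof -
  define pos where "pos = inv_into positions entry"
  define f where "f = entry \<circ> next_position \<circ> pos"
  have bij_pos: "bij_betw pos X positions"
    unfolding pos_def by (rule bij_betw_inv_into[OF bij_entry])
  have pos: "pos x \<in> positions" "entry (pos x) = x" if "x \<in> X" for x
    using that bij_pos bij_betw_inv_into_right[OF bij_entry] by (auto simp: pos_def bij_betw_def)
  have pos_entry: "pos (entry q) = q" if "q \<in> positions" for q
    using that bij_betw_inv_into_left[OF bij_entry] by (simp add: pos_def)
  have next_pos: "next_position q \<in> positions" if "q \<in> positions" for q
    using bij_next_position that by (auto simp: bij_betw_def)
  have step: "d x (f x) \<le> C" if "x \<in> X" for x
    using step_next_position[OF pos(1)[OF that]] pos(2)[OF that] by (simp add: f_def)
  have "\<exists>act. translation_like_action integer_group X d act \<and> (\<forall>x\<in>X. act x 1 = f x)"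
  proof (rule increasing_bijection_gives_translation_like_action[where r = "height \<circ> pos"])
    show "Metric_space X d" ..
    show "bij_betw f X X"
      unfolding f_def by (intro bij_betw_trans[OF bij_pos] bij_betw_trans[OF bij_next_position] bij_entry)
    show "(height \<circ> pos) x < (height \<circ> pos) (f x)" if "x \<in> X" for x
      using height_next_position[OF pos(1)[OF that]] pos_entry[OF next_pos[OF pos(1)[OF that]]]
      by (simp add: f_def)
  qed (fact step)
  then show ?thesis using step by fastforce
qed

end

section \<open>Tours of finite trees\<close>

text \<open>The end of a tour has to be close to its start \<open>v\<close> so that tours can be chained, both
  in the recursion over a tree and along a ray.\<close>

definition tour :: "('v \<Rightarrow> 'v \<Rightarrow> real) \<Rightarrow> 'v \<Rightarrow> 'v set \<Rightarrow> 'v list \<Rightarrow> bool" where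
  "tour d v A xs \<longleftrightarrow> xs \<noteq> [] \<and> distinct xs \<and> set xs = A \<and> hd xs = v \<and> d v (last xs) \<le> 1 \<and>
    successively (\<lambda>x y. d x y \<le> 3) xs"

text \<open>Following parents upwards from \<open>x\<close> leaves no choice, so the ancestors of \<open>x\<close> form a
  chain.\<close>

lemma common_descendant_comparable:
  assumes "single_valued (E\<inverse>)" "(a, x) \<in> E\<^sup>*" "(b, x) \<in> E\<^sup>*"
  shows "(a, b) \<in> E\<^sup>* \<or> (b, a) \<in> E\<^sup>*"
  using single_valued_confluent[OF assms(1), of x a b] assms(2,3)
  unfolding rtrancl_converse converse_iff by blast

text \<open>Well-foundedness together with finite branching stands for finiteness of the tree below \<open>v\<close>.
  A tour of the tree below \<open>v\<close> visits \<open>v\<close> and then, one after the other, the subtrees of the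
  children \<open>c\<^sub>1, c\<^sub>2, \<dots>\<close>, each along its reversed tour. Such a tour ends at \<open>c\<^sub>i\<close>, a neighbour of
  \<open>v\<close>, and the next one begins within 1 of \<open>c\<^sub>i\<^sub>+\<^sub>1\<close>, hence at distance at most \<open>1 + 1 + 1\<close>.\<close>

lemma tour_exists:
  assumes M: "Metric_space V d"
    and wf: "wf (E\<inverse>)"
    and parent_unique: "single_valued (E\<inverse>)"
    and E: "E \<subseteq> V \<times> V"
    and children_finite: "\<And>v. finite (E `` {v})"
    and edge: "\<And>v c. (v, c) \<in> E \<Longrightarrow> d v c \<le> 1"
    and "v \<in> V"
  shows "\<exists>xs. tour d v (E\<^sup>* `` {v}) xs"
  using wf \<open>v \<in> V\<close>
proof (induction v rule: wf_induct_rule)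
  case (less v)
  interpret Metric_space V d by (rule M)
  have desc_V: "E\<^sup>* `` {u} \<subseteq> V" if "u \<in> V" for u
    using that E by (auto elim: rtranclE)
  have no_cycle: False if "(v, c) \<in> E" "(c, v) \<in> E\<^sup>*" for c
    using that wf by (meson acyclic_converse acyclic_def rtrancl_into_trancl2 wf_acyclic)
  \<comment> \<open>If a child \<open>b\<close> were above another child \<open>c\<close>, it would be above the parent of \<open>c\<close>, which
    is \<open>v\<close>.\<close>
  have disj: "E\<^sup>* `` {b} \<inter> E\<^sup>* `` {c} = {}" if "(v, b) \<in> E" "(v, c) \<in> E" "b \<noteq> c" for b c
  proof -
    have False if "(v, b) \<in> E" "(v, c) \<in> E" "b \<noteq> c" "(b, c) \<in> E\<^sup>*" for b c
    proof -
      from that(4,3) obtain u where "(b, u) \<in> E\<^sup>*" "(u, c) \<in> E" by (auto elim: rtranclE)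
      then show False
        using that no_cycle parent_unique by (auto simp: single_valued_def)
    qed
    then show ?thesis
      using common_descendant_comparable[OF parent_unique] that by blast
  qed
  have "\<exists>xs. tour d v (insert v (\<Union>c\<in>B. E\<^sup>* `` {c})) xs" if "finite B" "B \<subseteq> E `` {v}" for B
    using that
  proof (induction B rule: finite_induct)
    case empty
    then show ?case using \<open>v \<in> V\<close> by (intro exI[of _ "[v]"]) (simp add: tour_def)
  next
    case (insert c B)
    let ?A = "insert v (\<Union>c\<in>B. E\<^sup>* `` {c})"
    have c: "(v, c) \<in> E" "c \<in> V" using insert.prems E by auto
    obtain xs where xs: "tour d v ?A xs" using insert by auto
    obtain ys where ys: "tour d c (E\<^sup>* `` {c}) ys" using less.IH[of c] c by auto
    have dj: "?A \<inter> E\<^sup>* `` {c} = {}"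
      using disj[OF c(1)] no_cycle[OF c(1)] insert.hyps(2) insert.prems by fastforce
    have "?A \<subseteq> E\<^sup>* `` {v}"
      using insert.prems by (auto intro: converse_rtrancl_into_rtrancl)
    moreover have "last xs \<in> ?A" "last ys \<in> E\<^sup>* `` {c}"
      using last_in_set[of xs] last_in_set[of ys] xs ys unfolding tour_def by metis+
    ultimately have V: "last xs \<in> V" "last ys \<in> V"
      using desc_V[OF c(2)] desc_V[OF \<open>v \<in> V\<close>] by blast+
    have "d (last xs) (last ys) \<le> d (last xs) v + (d v c + d c (last ys))"
      using triangle V c(2) \<open>v \<in> V\<close> by (meson add_left_mono order_trans)
    also have "\<dots> \<le> 3"
      using xs ys edge[OF c(1)] commute[of v "last xs"] by (simp add: tour_def)
    finally have "tour d v (insert v (\<Union>c\<in>insert c B. E\<^sup>* `` {c})) (xs @ rev ys)"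
      using xs ys dj edge[OF c(1)] unfolding tour_def
      by (auto simp: successively_append_iff hd_rev last_rev commute)
    then show ?case by blast
  qed
  from this[OF children_finite order_refl]
  have "\<exists>xs. tour d v (insert v (\<Union>c\<in>E `` {v}. E\<^sup>* `` {c})) xs" .
  moreover have "E\<^sup>* `` {v} = insert v (\<Union>c\<in>E `` {v}. E\<^sup>* `` {c})"
    by (auto elim: converse_rtranclE intro: converse_rtrancl_into_rtrancl)
  ultimately show ?case by simp
qed


section \<open>Decomposing an infinite tree into rays with finite bushes\<close>

text \<open>The pairs in \<open>E\<close> lead from a parent to its child. Only an upper bound on the metric
  along edges is required, so that the metric may be that of a graph which the tree spans.\<close>

locale infinite_rooted_tree = Metric_space V d
  for V :: "'v set" and d :: "'v \<Rightarrow> 'v \<Rightarrow> real" +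
  fixes E :: "('v \<times> 'v) set" and root :: 'v and depth :: "'v \<Rightarrow> nat"
  assumes root: "root \<in> V"
    and E_subset: "E \<subseteq> V \<times> V"
    and parent_unique: "single_valued (E\<inverse>)"
    and parent_exists: "\<lbrakk>v \<in> V; v \<noteq> root\<rbrakk> \<Longrightarrow> \<exists>u. (u, v) \<in> E"
    and depth_less: "(u, v) \<in> E \<Longrightarrow> depth u < depth v"
    and children_finite: "finite (E `` {v})"
    and edge: "(u, v) \<in> E \<Longrightarrow> d u v \<le> 1"
    and infinite: "infinite V"
begin

text \<open>The accessible part of the relation from children to parents consists of the vertices
  from which no infinite path descends. By finite branching these are the vertices with finitely many
  descendants, but accessibility gives at once a trunk child for each trunk vertex and an
  induction principle for the other vertices, with no appeal to Koenig's lemma.\<close>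

definition trunk :: "'v set" where
  "trunk = V - Wellfounded.acc (E\<inverse>)"

text \<open>Deleting the edges that lead into the trunk breaks the tree into the bushes, one for each
  trunk vertex.\<close>

definition bush_edges :: "('v \<times> 'v) set" where
  "bush_edges = E \<inter> (UNIV \<times> Wellfounded.acc (E\<inverse>))"

lemma V_subset_descendants_root: "V \<subseteq> E\<^sup>* `` {root}"
proof
  fix v assume "v \<in> V"
  then show "v \<in> E\<^sup>* `` {root}"
  proof (induction "depth v" arbitrary: v rule: less_induct)
    case less
    show ?case
    proof (cases "v = root")
      case False
      then obtain u where u: "(u, v) \<in> E" using parent_exists less.prems by blast
      then have "u \<in> E\<^sup>* `` {root}" using less.hyps depth_less E_subset by blast
      then show ?thesis using u by (auto intro: rtrancl_into_rtrancl)
    qed simp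
  qed
qed

text \<open>With the root outside the trunk, the whole tree would be well-founded, and the list
  that tours it would make it finite.\<close>

lemma root_in_trunk: "root \<in> trunk"
proof (rule ccontr)
  assume "root \<notin> trunk"
  then have "root \<in> Wellfounded.acc (E\<inverse>)" using root by (simp add: trunk_def)
  then have "v \<in> Wellfounded.acc (E\<inverse>)" if "v \<in> V" for v
    using acc_downwards[of root "E\<inverse>" v] V_subset_descendants_root that
    by (auto simp: rtrancl_converse)
  moreover have "v \<in> Wellfounded.acc (E\<inverse>)" if "v \<notin> V" for v
    using that E_subset by (blast intro: acc.accI)
  ultimately have "wf (E\<inverse>)" by (intro acc_wfI) blast
  then obtain xs where "tour d root (E\<^sup>* `` {root}) xs"
    using tour_exists[OF Metric_space_axioms _ parent_unique E_subset children_finite edge root] by blast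
  then have "finite (E\<^sup>* `` {root})" unfolding tour_def by (metis List.finite_set)
  then show False using infinite V_subset_descendants_root finite_subset by blast
qed

lemma child_in_trunk:
  assumes "x \<in> trunk"
  shows "\<exists>c\<in>trunk. (x, c) \<in> E"
proof -
  have "x \<notin> Wellfounded.acc (E\<inverse>)" using assms by (simp add: trunk_def)
  then obtain c where "(x, c) \<in> E" "c \<notin> Wellfounded.acc (E\<inverse>)"
    using acc.accI[of x "E\<inverse>"] by auto
  then show ?thesis using E_subset by (auto simp: trunk_def)
qed

lemma bush_tour:
  assumes "x \<in> V"
  shows "\<exists>xs. tour d x (bush_edges\<^sup>* `` {x}) xs"
proof (rule tour_exists[OF Metric_space_axioms])
  have "Wellfounded.acc (E\<inverse>) \<subseteq> Wellfounded.acc (bush_edges\<inverse>)"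
    by (rule acc_subset) (auto simp: bush_edges_def)
  then have "v \<in> Wellfounded.acc (bush_edges\<inverse>)" for v
    using acc.accI[of v "bush_edges\<inverse>"] by (auto simp: bush_edges_def)
  then show "wf (bush_edges\<inverse>)" by (intro acc_wfI) blast
  show "single_valued (bush_edges\<inverse>)" 
    using parent_unique by (auto simp: bush_edges_def single_valued_def)
  show "finite (bush_edges `` {v})" for v
    by (rule finite_subset[OF _ children_finite[of v]]) (auto simp: bush_edges_def)
qed (use E_subset edge assms in \<open>auto simp: bush_edges_def\<close>)

lemma bushes_cover: "(\<Union>x\<in>trunk. bush_edges\<^sup>* `` {x}) = V"
proof
  have "v \<in> V" if "(x, v) \<in> bush_edges\<^sup>*" "x \<in> V" for x v
    using that E_subset by (auto simp: bush_edges_def elim: rtranclE)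
  then show "(\<Union>x\<in>trunk. bush_edges\<^sup>* `` {x}) \<subseteq> V" by (auto simp: trunk_def)
  show "V \<subseteq> (\<Union>x\<in>trunk. bush_edges\<^sup>* `` {x})"
  proof
    fix v assume "v \<in> V"
    then show "v \<in> (\<Union>x\<in>trunk. bush_edges\<^sup>* `` {x})"
    proof (induction "depth v" arbitrary: v rule: less_induct)
      case less
      show ?case
      proof (cases "v \<in> trunk")
        case False
        then obtain u where u: "(u, v) \<in> E" using parent_exists less.prems root_in_trunk by blast
        then have "u \<in> (\<Union>x\<in>trunk. bush_edges\<^sup>* `` {x})" using less.hyps depth_less E_subset by blast
        moreover have "(u, v) \<in> bush_edges" using u False less.prems by (simp add: bush_edges_def trunk_def)
        ultimately show ?thesis by (auto intro: rtrancl_into_rtrancl)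
      qed auto
    qed
  qed
qed

text \<open>Of two trunk vertices above \<open>v\<close>, one is above the other within a bush; but no bush edge
  leads into the trunk, so the two are equal.\<close>

lemma bushes_disjoint:
  assumes "x \<in> trunk" "y \<in> trunk" "(x, v) \<in> bush_edges\<^sup>*" "(y, v) \<in> bush_edges\<^sup>*"
  shows "x = y"
proof -
  have "single_valued (bush_edges\<inverse>)"
    using parent_unique by (auto simp: bush_edges_def single_valued_def)
  then have "(x, y) \<in> bush_edges\<^sup>* \<or> (y, x) \<in> bush_edges\<^sup>*"
    using common_descendant_comparable assms by metis
  then show ?thesis
    using assms(1,2) by (auto simp: bush_edges_def trunk_def elim: rtranclE)
qed

text \<open>The bijection \<^const>\<open>int_encode\<close> maps \<open>0, 1, 2, \<dots>\<close> to \<open>0, 2, 4, \<dots>\<close> and \<open>-1, -2, \<dots>\<close> to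
  \<open>1, 3, \<dots>\<close>, which is the order in which the bi-infinite sequence runs through the ray. Blocks with
  negative index are reversed because there the ray is climbed.\<close>

lemma translation_like_action_step_3:
  "\<exists>act. translation_like_action integer_group V d act \<and> (\<forall>v\<in>V. d v (act v 1) \<le> 3)"
proof -
  obtain L where L: "\<And>x. x \<in> trunk \<Longrightarrow> tour d x (bush_edges\<^sup>* `` {x}) (L x)"
    using bush_tour by (metis DiffD1 trunk_def)
  obtain p where p: "\<And>x. x \<in> trunk \<Longrightarrow> p x \<in> trunk" "\<And>x. x \<in> trunk \<Longrightarrow> (x, p x) \<in> E"
    using child_in_trunk by metis
  have trunk_V: "x \<in> V" if "x \<in> trunk" for x using that by (simp add: trunk_def)
  define S where "S = trunk - p ` trunk"
  define ray where "ray s n = (p ^^ n) s" for s n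
  define M where "M s k = (let xs = L (ray s (int_encode k)) in if k \<ge> 0 then xs else rev xs)" for s k
  have p_inj: "x = y" if "x \<in> trunk" "y \<in> trunk" "p x = p y" for x y
    using p(2)[OF that(1)] p(2)[OF that(2)] that(3) parent_unique by (auto simp: single_valued_def)
  have ray_in_trunk: "ray s n \<in> trunk" if "s \<in> S" for s n
    using that p(1) by (induction n) (auto simp: ray_def S_def)
  \<comment> \<open>Climbing along chosen edges stops by the decrease of depth, and it stops in \<open>S\<close>.\<close>
  have ray_cover: "\<exists>s\<in>S. \<exists>n. ray s n = x" if "x \<in> trunk" for x
    using that
  proof (induction "depth x" arbitrary: x rule: less_induct)
    case less
    show ?case
    proof (cases "x \<in> S")
      case True
      then show ?thesis by (metis funpow_0 ray_def)
    next
      case False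
      then obtain y where y: "y \<in> trunk" "x = p y" using less.prems by (auto simp: S_def)
      then obtain s n where "s \<in> S" "ray s n = y" using less.hyps depth_less p(2) by blast
      then have "ray s (Suc n) = x" using y by (simp add: ray_def)
      then show ?thesis using \<open>s \<in> S\<close> by blast
    qed
  qed
  have ray_inj: "s = t \<and> m = n" if "s \<in> S" "t \<in> S" "ray s m = ray t n" for s t m n
    using that(3)
  proof (induction m arbitrary: n)
    case 0
    then show ?case
      using that(1) ray_in_trunk[OF that(2)] by (cases n) (auto simp: ray_def S_def)
  next
    case (Suc m)
    show ?case
    proof (cases n)
      case 0
      then show ?thesis
        using Suc.prems that(2) ray_in_trunk[OF that(1), of m] by (auto simp: ray_def S_def)
    next
      case (Suc l)
      then have "p (ray s m) = p (ray t l)" using Suc.prems by (simp add: ray_def)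
      then have "ray s m = ray t l" using p_inj ray_in_trunk that(1,2) by blast
      then show ?thesis using Suc Suc.IH by blast
    qed
  qed
  have ray_1: "d (ray s n) (ray s (Suc n)) \<le> 1" if "s \<in> S" for s n
    using edge[OF p(2)[OF ray_in_trunk[OF that, of n]]] by (simp add: ray_def)
  have ray_2: "d (ray s n) (ray s (Suc (Suc n))) \<le> 2" if "s \<in> S" for s n
    using ray_1[OF that, of n] ray_1[OF that, of "Suc n"]
      triangle[OF trunk_V[OF ray_in_trunk[OF that, of n]] trunk_V[OF ray_in_trunk[OF that, of "Suc n"]]
        trunk_V[OF ray_in_trunk[OF that, of "Suc (Suc n)"]]] by linarith
  have L_props: "L x \<noteq> []" "distinct (L x)" "set (L x) = bush_edges\<^sup>* `` {x}" "hd (L x) = x"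
    "d x (last (L x)) \<le> 1" "successively (\<lambda>x y. d x y \<le> 3) (L x)" "last (L x) \<in> V" if "x \<in> trunk" for x
  proof -
    show props: "L x \<noteq> []" "distinct (L x)" "set (L x) = bush_edges\<^sup>* `` {x}" "hd (L x) = x"
      "d x (last (L x)) \<le> 1" "successively (\<lambda>x y. d x y \<le> 3) (L x)"
      using L[OF that] by (simp_all add: tour_def)
    show "last (L x) \<in> V"
      using last_in_set[OF props(1)] props(3) bushes_cover that by blast
  qed
  have set_M: "set (M s k) = bush_edges\<^sup>* `` {ray s (int_encode k)}" if "s \<in> S" for s k
    using L_props(3)[OF ray_in_trunk[OF that]] by (simp add: M_def Let_def)
  interpret block_lines V d S M 3
  proof
    fix s k assume s: "s \<in> S"
    let ?x = "ray s (int_encode k)" and ?y = "ray s (int_encode (k + 1))"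
    note x = L_props[OF ray_in_trunk[OF s, of "int_encode k"]]
    note y = L_props[OF ray_in_trunk[OF s, of "int_encode (k + 1)"]]
    have V: "?x \<in> V" "?y \<in> V" using trunk_V ray_in_trunk s by auto
    show "M s k \<noteq> []" "distinct (M s k)" "successively (\<lambda>x y. d x y \<le> 3) (M s k)"
      using x by (auto simp: M_def Let_def commute)
    consider "k \<ge> 0" | "k = -1" | "k < -1" by linarith
    then show "d (last (M s k)) (hd (M s (k + 1))) \<le> 3"
    proof cases
      case 1
      then have "int_encode (k + 1) = Suc (Suc (int_encode k))"
        by (simp add: int_encode_def sum_encode_def nat_add_distrib)
      then have "d ?x ?y \<le> 2" using ray_2[OF s] by simp
      then have "d (last (L ?x)) ?y \<le> 3"
        using x(5) triangle[OF x(7) V] commute[of ?x "last (L ?x)"] by linarith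
      then show ?thesis using 1 y(4) by (simp add: M_def Let_def)
    next
      \<comment> \<open>The turning point: \<open>rev (L x\<^sub>1)\<close> ends at \<open>x\<^sub>1\<close>, and \<open>L x\<^sub>0\<close> starts at \<open>x\<^sub>0\<close>.\<close>
      case 2
      then have "int_encode k = Suc 0" "int_encode (k + 1) = 0"
        by (simp_all add: int_encode_def sum_encode_def)
      then show ?thesis
        using 2 x(1,4) y(4) ray_1[OF s, of 0] by (simp add: M_def Let_def last_rev commute)
    next
      case 3
      then have "int_encode k = Suc (Suc (int_encode (k + 1)))"
        by (simp add: int_encode_def sum_encode_def nat_diff_distrib' flip: nat_add_distrib)
      then have "d ?y ?x \<le> 2" using ray_2[OF s] by simp
      then have "d ?x (last (L ?y)) \<le> 3"
        using y(5) triangle[OF V(1,2) y(7)] commute[of ?x ?y] by linarith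
      then show ?thesis using 3 x(1,4) y(1) by (simp add: M_def Let_def last_rev hd_rev)
    qed
  next
    have "(\<Union>s\<in>S. \<Union>k. set (M s k)) = (\<Union>x\<in>trunk. bush_edges\<^sup>* `` {x})"
    proof
      show "(\<Union>s\<in>S. \<Union>k. set (M s k)) \<subseteq> (\<Union>x\<in>trunk. bush_edges\<^sup>* `` {x})"
        using set_M ray_in_trunk by blast
      show "(\<Union>x\<in>trunk. bush_edges\<^sup>* `` {x}) \<subseteq> (\<Union>s\<in>S. \<Union>k. set (M s k))"
      proof clarify
        fix x v assume "x \<in> trunk" "(x, v) \<in> bush_edges\<^sup>*"
        moreover obtain s n where s: "s \<in> S" "ray s n = x" using ray_cover \<open>x \<in> trunk\<close> by blast
        ultimately have "v \<in> set (M s (int_decode n))" using set_M by simp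
        then show "v \<in> (\<Union>s\<in>S. \<Union>k. set (M s k))" using s by blast
      qed
    qed
    then show "(\<Union>s\<in>S. \<Union>k. set (M s k)) = V" using bushes_cover by simp
  next
    fix s t v k l
    assume st: "s \<in> S" "t \<in> S" and v: "v \<in> set (M s k)" "v \<in> set (M t l)"
    have "ray s (int_encode k) = ray t (int_encode l)"
      using v set_M[OF st(1)] set_M[OF st(2)] ray_in_trunk[OF st(1)] ray_in_trunk[OF st(2)] bushes_disjoint[where v = v]
      by simp
    then show "s = t \<and> k = l" using ray_inj st by (metis int_encode_inverse)
  qed
  show ?thesis by (rule translation_like_action)
qed

end

section \<open>Breadth-first spanning trees of graphs\<close>

lemma infinite_verts:
  assumes "wf_multigraph G" "\<not> finite_multigraph G" "locally_finite_multigraph G"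
  shows "infinite (verts G)"
proof
  assume "finite (verts G)"
  moreover have "edges G \<subseteq> (\<Union>v\<in>verts G. incident_edges G v)"
  proof
    fix e assume e: "e \<in> edges G"
    obtain u v where "ends G e = Upair u v" by (cases "ends G e") auto
    then show "e \<in> (\<Union>v\<in>verts G. incident_edges G v)"
      using e assms(1) by (force simp: wf_multigraph_def incident_edges_def)
  qed
  ultimately show False
    using assms(2,3) unfolding finite_multigraph_def locally_finite_multigraph_def
    by (meson finite_UN_I finite_subset)
qed

lemma finite_neighbours:
  assumes "locally_finite_multigraph G" "u \<in> verts G"
  shows "finite {v. \<exists>e\<in>edges G. ends G e = Upair v u}"
proof (rule finite_subset)
  show "{v. \<exists>e\<in>edges G. ends G e = Upair v u} \<subseteq> (\<Union>e\<in>incident_edges G u. set_uprod (ends G e))"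
    by (force simp: incident_edges_def)
  have "finite (set_uprod q)" for q :: "'a uprod" by (cases q) auto
  then show "finite (\<Union>e\<in>incident_edges G u. set_uprod (ends G e))"
    using assms by (auto simp: locally_finite_multigraph_def)
qed

text \<open>The first step of a shortest path. Choosing such a neighbour as the parent of each vertex
  other than a root \<open>w\<close> gives a spanning tree whose depth function is the distance to \<open>w\<close>.\<close>

lemma neighbour_towards:
  assumes "connected_multigraph G" "v \<in> verts G" "w \<in> verts G" "v \<noteq> w"
  shows "\<exists>u. (\<exists>e\<in>edges G. ends G e = Upair v u) \<and> path_dist G u w < path_dist G v w"
proof -
  obtain es where es: "edge_path G v es w" "path_dist G v w = real (length es)"
    using path_dist_attained[OF assms(1-3)] .
  from es(1) show ?thesis
  proof cases
    case Nil
    then show ?thesis using assms(4) by simp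
  next
    case (Cons e u fs)
    then show ?thesis using es(2) path_dist_le[of G u fs w] by force
  qed
qed

theorem theorem1p5:
  fixes \<Gamma> :: "('v, 'e) multigraph"
  assumes "wf_multigraph \<Gamma>"
    and "\<not> finite_multigraph \<Gamma>"
    and "locally_finite_multigraph \<Gamma>"
    and "connected_multigraph \<Gamma>"
  shows "\<exists>act :: 'v \<Rightarrow> int \<Rightarrow> 'v.
    translation_like_action_on_graph integer_group \<Gamma> act \<and>
    (\<forall>v\<in>verts \<Gamma>. path_dist \<Gamma> v (act v 1) \<le> 3)"
proof -
  let ?V = "verts \<Gamma>"
  have inf: "infinite ?V" using infinite_verts assms by blast
  then obtain root where root: "root \<in> ?V" by (metis all_not_in_conv finite.emptyI)
  have ends_V: "u \<in> ?V" "v \<in> ?V" if "e \<in> edges \<Gamma>" "ends \<Gamma> e = Upair v u" for e u v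
    using that assms(1) by (auto simp: wf_multigraph_def)
  obtain par where par: "\<And>v. v \<in> ?V \<Longrightarrow> v \<noteq> root \<Longrightarrow>
      (\<exists>e\<in>edges \<Gamma>. ends \<Gamma> e = Upair v (par v)) \<and> path_dist \<Gamma> (par v) root < path_dist \<Gamma> v root"
    using neighbour_towards[OF assms(4) _ root] by metis
  \<comment> \<open>Each vertex other than the root contributes exactly one edge, so parents are unique even if
    the graph has cycles, loops or multiple edges.\<close>
  define E where "E = {(par v, v) | v. v \<in> ?V \<and> v \<noteq> root}"
  have E: "(\<exists>e\<in>edges \<Gamma>. ends \<Gamma> e = Upair v u) \<and> path_dist \<Gamma> u root < path_dist \<Gamma> v root"
    if "(u, v) \<in> E" for u v
    using that par by (auto simp: E_def)
  interpret Metric_space ?V "path_dist \<Gamma>"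
    by (rule Metric_space_path_dist[OF assms(1,4)])
  interpret infinite_rooted_tree ?V "path_dist \<Gamma>" E root "\<lambda>v. nat \<lfloor>path_dist \<Gamma> v root\<rfloor>"
  proof
    show "E \<subseteq> ?V \<times> ?V" using E ends_V by fast
    show "single_valued (E\<inverse>)" by (auto simp: E_def single_valued_def)
    show "\<exists>u. (u, v) \<in> E" if "v \<in> ?V" "v \<noteq> root" for v
      using that by (auto simp: E_def)
    show "nat \<lfloor>path_dist \<Gamma> u root\<rfloor> < nat \<lfloor>path_dist \<Gamma> v root\<rfloor>" if "(u, v) \<in> E" for u v
      using E[OF that] by (simp add: path_dist_def)
    show "finite (E `` {u})" for u
    proof (cases "u \<in> ?V")
      case True
      show ?thesis
        by (rule finite_subset[OF _ finite_neighbours[OF assms(3) True]]) (use E in blast)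
    next
      case False
      then have "E `` {u} = {}" using E ends_V by fast
      then show ?thesis by simp
    qed
    show "path_dist \<Gamma> u v \<le> 1" if "(u, v) \<in> E" for u v
    proof -
      obtain e where "e \<in> edges \<Gamma>" "ends \<Gamma> e = Upair v u"
        using E[OF \<open>(u, v) \<in> E\<close>] by blast
      then have e: "e \<in> edges \<Gamma>" "ends \<Gamma> e = Upair u v" by (simp_all add: Upair_inject)
      then have "edge_path \<Gamma> u [e] v"
        using ends_V by (auto intro!: edge_path.intros)
      from path_dist_le[OF this] show ?thesis by simp
    qed
  qed (use root inf in auto)
  show ?thesis
    using translation_like_action_step_3 by (auto simp: translation_like_action_on_graph_def)
qed

end
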